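(* If $G$ is a graph with no universal vertex, then $$\mathrm{vv}(G)\le\left\lfloor\frac{n(G)\Delta(G)-1}{\Delta(G)+1}\right\rfloor,$$ and the bound is sharp (equality holds, e.g., for the cocktail party graph $K_{k\times 2}$, $k\ge 2$).
   Context: All graphs are finite and simple; $n(G)$ is the order and $\Delta(G)$ the maximum degree of $G$. A universal vertex is adjacent to all other vertices. $K_{k\times 2}$ is the complete $k$-partite graph with all parts of size $2$. For $x\in V(G)$, a set $S\subseteq V(G)\setminus\{x\}$ is an $x$-visibility set if for every $y\in S$ there exists a shortest $x,y$-path $P$ with $V(P)\cap S=\{y\}$; $v_x(G)$ is the maximum size of an $x$-visibility set and $\mathrm{vv}(G)=\max_{x\in V(G)} v_x(G)$.
   Formalization: The graph is additionally assumed to have at least one edge, because an edgeless graph on at least two vertices has no universal vertex and vv = 0 while the bound equals −1. *)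

theory Defs
  imports Complex_Main "Graph_Theory.Pair_Digraph"
begin

text \<open>
  Finite simple graphs are the members of the locale \<^locale>\<open>graph\<close>: finite symmetric digraphs
  without loops and parallel arcs. Every edge is present as two opposite arcs, so the degree of a
  vertex is its \<^const>\<open>out_degree\<close>. The null graph is a \<^locale>\<open>graph\<close> too; the maxima below are
  unspecified for it.

  The bound on \<open>vv\<close> fails for edgeless graphs with at least two vertices: they have no universal
  vertex and \<open>vv G = 0\<close>, but the bound evaluates to \<open>-1\<close>. It is therefore stated for graphs with
  at least one edge.
\<close>

definition max_degree :: "('a, 'b) pre_digraph \<Rightarrow> nat" where
  "max_degree G = Max (out_degree G ` verts G)"

definition universal_vertex :: "('a, 'b) pre_digraph \<Rightarrow> 'a \<Rightarrow> bool" where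
  "universal_vertex G u \<longleftrightarrow> u \<in> verts G \<and> (\<forall>v \<in> verts G - {u}. u \<rightarrow>\<^bsub>G\<^esub> v)"

definition shortest_path :: "('a, 'b) pre_digraph \<Rightarrow> 'a \<Rightarrow> 'b awalk \<Rightarrow> 'a \<Rightarrow> bool" where
  "shortest_path G x P y \<longleftrightarrow>
     pre_digraph.apath G x P y \<and> (\<forall>Q. pre_digraph.apath G x Q y \<longrightarrow> length P \<le> length Q)"

text \<open>
  Graphs need not be connected: a vertex in another component than \<open>x\<close> has no shortest path
  from \<open>x\<close>, hence belongs to no \<open>x\<close>-visibility set.
\<close>

definition visibility_set :: "('a, 'b) pre_digraph \<Rightarrow> 'a \<Rightarrow> 'a set \<Rightarrow> bool" where
  "visibility_set G x S \<longleftrightarrow> S \<subseteq> verts G - {x} \<and>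
     (\<forall>y \<in> S. \<exists>P. shortest_path G x P y \<and> set (pre_digraph.awalk_verts G x P) \<inter> S = {y})"

definition vertex_visibility :: "('a, 'b) pre_digraph \<Rightarrow> 'a \<Rightarrow> nat" where
  "vertex_visibility G x = Max (card ` {S. visibility_set G x S})"

definition vv :: "('a, 'b) pre_digraph \<Rightarrow> nat" where
  "vv G = Max (vertex_visibility G ` verts G)"

text \<open>
  The complete \<open>k\<close>-partite graph with all parts of size \<open>m\<close>; part \<open>i\<close> consists of
  the pairs with first component \<open>i\<close>.
\<close>

definition complete_multipartite :: "nat \<Rightarrow> nat \<Rightarrow> (nat \<times> nat) pair_pre_digraph" where
  "complete_multipartite k m =
     \<lparr> pverts = {..<k} \<times> {..<m},
       parcs = {(u, v). u \<in> {..<k} \<times> {..<m} \<and> v \<in> {..<k} \<times> {..<m} \<and> fst u \<noteq> fst v} \<rparr>"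

abbreviation cocktail_party :: "nat \<Rightarrow> (nat \<times> nat, (nat \<times> nat) \<times> (nat \<times> nat)) pre_digraph" where
  "cocktail_party k \<equiv> with_proj (complete_multipartite k 2)"

end

theory Submission
  imports Defs
begin

text \<open>
  Let \<open>S\<close> be an \<open>x\<close>-visibility set, \<open>T\<close> its complement and \<open>\<Delta>\<close> the maximum degree. The last arc
  of a shortest path witnessing \<open>y \<in> S\<close> leads from \<open>T\<close> to \<open>y\<close>, so the arcs that start in \<open>T\<close> reach
  all of \<open>S\<close> and \<open>|S| \<le> |T| \<Delta>\<close>. If some \<open>y \<in> S\<close> is not adjacent to \<open>x\<close>, the first arc of its
  path ends in \<open>T\<close> and is wasted, so \<open>|S| \<le> |T| \<Delta> - 1\<close>, which is the bound. Otherwise \<open>|S| \<le> \<Delta>\<close>,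
  and \<open>|T| \<ge> 2\<close> because \<open>x\<close> is not universal, which gives the bound again.
  In the cocktail party graph the neighbourhood of a vertex attains the bound.
\<close>

section \<open>Arcs and paths at visibility sets\<close>

context wf_digraph
begin

lemma visibility_setE:
  assumes "visibility_set G x S" "y \<in> S"
  obtains P where "apath x P y" "set (awalk_verts x P) \<inter> S = {y}" "P \<noteq> []"
proof -
  from assms obtain P where P: "apath x P y" "set (awalk_verts x P) \<inter> S = {y}" and "x \<noteq> y"
    unfolding visibility_set_def shortest_path_def by blast
  from P(1) \<open>x \<noteq> y\<close> have "P \<noteq> []"
    by (auto simp: apath_Nil_iff)
  with P show thesis
    by (rule that)
qed

text \<open>A path repeats no vertex, so the tail of its last arc is a vertex of the path other than
  \<open>y\<close>. Since the path meets \<open>S\<close> only in \<open>y\<close>, that tail lies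
  outside \<open>S\<close>.\<close>

lemma visibility_set_last_arc:
  assumes "visibility_set G x S" "y \<in> S"
  obtains e where "e \<in> arcs G" "tail G e \<in> verts G - S" "head G e = y"
proof -
  from assms obtain P where P: "apath x P y" "set (awalk_verts x P) \<inter> S = {y}" "P \<noteq> []"
    by (rule visibility_setE)
  then obtain Q e where Q: "P = Q @ [e]"
    by (cases P rule: rev_cases) auto
  with P(1) have e: "e \<in> arcs G" "head G e = y" "tail G e \<noteq> y"
    by (auto simp: apath_append_iff apath_Cons_iff apath_Nil_iff)
  have "tail G e \<in> set (awalk_verts x P)"
    by (rule awalk_verts_arc1) (simp add: Q)
  with P(2) e(3) have "tail G e \<notin> S"
    by blast
  with e show thesis
    by (intro that[of e]) auto
qed

text \<open>Non-adjacency makes the head of the first arc differ from \<open>y\<close>, and no other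
  vertex of the path can belong to \<open>S\<close>.\<close>

lemma visibility_set_first_arc:
  assumes "visibility_set G x S" "y \<in> S" "\<not> x \<rightarrow> y"
  obtains e where "e \<in> arcs G" "tail G e = x" "head G e \<in> verts G - S"
proof -
  from assms(1,2) obtain P where P: "apath x P y" "set (awalk_verts x P) \<inter> S = {y}" "P \<noteq> []"
    by (rule visibility_setE)
  then obtain e Q where Q: "P = e # Q"
    by (cases P) auto
  with P(1) have e: "e \<in> arcs G" "tail G e = x"
    by (auto simp: apath_Cons_iff)
  then have "head G e \<noteq> y"
    using assms(3) by (auto simp: arcs_ends_conv)
  moreover have "head G e \<in> set (awalk_verts x P)"
    using P(1) Q by (intro awalk_verts_arc2) (auto simp: apath_def)
  ultimately have "head G e \<notin> S"
    using P(2) by blast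
  with e show thesis
    by (intro that[of e]) auto
qed

text \<open>Serves the lower bound in the sharpness part. A single arc is a shortest path because
  \<open>x \<noteq> y\<close> rules out the empty one, and it passes through no further vertex of
  \<open>S\<close>.\<close>

lemma visibility_set_neighbours:
  assumes "x \<notin> S" "\<And>y. y \<in> S \<Longrightarrow> x \<rightarrow> y"
  shows "visibility_set G x S"
  unfolding visibility_set_def
proof (intro conjI ballI)
  show "S \<subseteq> verts G - {x}"
    using assms adj_in_verts(2) by blast
  fix y assume y: "y \<in> S"
  with assms(2) obtain e where e: "e \<in> arcs G" "tail G e = x" "head G e = y"
    by (blast elim: reachableE)
  have "x \<noteq> y"
    using assms(1) y by auto
  then have "shortest_path G x [e] y"
    using e by (auto simp: shortest_path_def apath_Cons_iff apath_Nil_iff Suc_le_eq)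
  moreover have "set (awalk_verts x [e]) \<inter> S = {y}"
    using e y assms(1) by auto
  ultimately show "\<exists>P. shortest_path G x P y \<and> set (awalk_verts x P) \<inter> S = {y}"
    by blast
qed

end

section \<open>The upper bound\<close>

context fin_digraph
begin

lemma out_degree_le_max_degree: "v \<in> verts G \<Longrightarrow> out_degree G v \<le> max_degree G"
  by (simp add: max_degree_def)

lemma max_degree_pos:
  assumes "arcs G \<noteq> {}"
  shows "0 < max_degree G"
proof -
  from assms obtain e where e: "e \<in> arcs G"
    by blast
  then have "0 < out_degree G (tail G e)"
    by (auto simp: out_degree_def card_gt_0_iff finite_out_arcs)
  also have "\<dots> \<le> max_degree G"
    using e by (intro out_degree_le_max_degree) simp
  finally show ?thesis .
qed

lemma finite_visibility_sets: "finite {S. visibility_set G x S}"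
  by (rule finite_subset[of _ "Pow (verts G)"]) (auto simp: visibility_set_def)

lemma card_visibility_set_le_vv:
  assumes "x \<in> verts G" "visibility_set G x S"
  shows "card S \<le> vv G"
proof -
  have "card S \<le> vertex_visibility G x"
    unfolding vertex_visibility_def using assms(2) finite_visibility_sets by (intro Max_ge) auto
  also have "\<dots> \<le> vv G"
    unfolding vv_def using assms(1) by (intro Max_ge) auto
  finally show ?thesis .
qed

lemma vv_attained:
  assumes "verts G \<noteq> {}"
  obtains x S where "x \<in> verts G" "visibility_set G x S" "vv G = card S"
proof -
  have "vv G \<in> vertex_visibility G ` verts G"
    unfolding vv_def using assms by (intro Max_in) auto
  then obtain x where x: "x \<in> verts G" "vv G = vertex_visibility G x"
    by blast
  \<comment> \<open>The empty set keeps the inner \<open>Max\<close> from ranging over an empty set,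
    so that this maximum is attained.\<close>
  have "visibility_set G x {}"
    by (simp add: visibility_set_def)
  then have "vertex_visibility G x \<in> card ` {S. visibility_set G x S}"
    unfolding vertex_visibility_def using finite_visibility_sets by (intro Max_in) auto
  with x that show thesis
    by auto
qed

lemma card_visibility_set_less:
  assumes "arcs G \<noteq> {}" "x \<in> verts G" "\<not> universal_vertex G x" and S: "visibility_set G x S"
  shows "card S < card (verts G - S) * max_degree G"
proof (cases "\<forall>y\<in>S. x \<rightarrow> y")
  case True
  then have "S \<subseteq> head G ` out_arcs G x"
    by (auto elim!: reachableE)
  then have "card S \<le> out_degree G x"
    unfolding out_degree_def by (metis card_image_le card_mono finite_imageI finite_out_arcs le_trans)
  also have "\<dots> \<le> max_degree G"
    using assms(2) by (rule out_degree_le_max_degree)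
  \<comment> \<open>Strict because an arc exists, so the maximum degree is positive. The factor 2 is
    paid for by two vertices outside \<open>S\<close>.\<close>
  also have "\<dots> < 2 * max_degree G"
    using max_degree_pos[OF assms(1)] by simp
  also have "\<dots> \<le> card (verts G - S) * max_degree G"
  proof (rule mult_le_mono1)
    \<comment> \<open>\<open>x\<close> lies outside \<open>S\<close> by definition, and a
      non-neighbour \<open>z\<close> of \<open>x\<close> does too, since in this case all of
      \<open>S\<close> is adjacent to \<open>x\<close>.\<close>
    obtain z where z: "z \<in> verts G" "z \<noteq> x" "\<not> x \<rightarrow> z"
      using assms(2,3) by (auto simp: universal_vertex_def)
    then have "{x, z} \<subseteq> verts G - S"
      using True assms(2) S by (auto simp: visibility_set_def)
    then have "card {x, z} \<le> card (verts G - S)"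
      by (intro card_mono) auto
    with z show "2 \<le> card (verts G - S)"
      by simp
  qed
  finally show ?thesis .
next
  case False
  with S obtain a where a: "a \<in> arcs G" "tail G a = x" "head G a \<in> verts G - S"
    by (blast elim: visibility_set_first_arc)
  let ?A = "\<Union>t\<in>verts G - S. out_arcs G t"
  have fin: "finite ?A"
    by (auto simp: finite_out_arcs)
  have "a \<in> ?A"
    using a assms(2) S by (auto simp: visibility_set_def)
  \<comment> \<open>The arc chosen for \<open>y\<close> ends in \<open>S\<close> while
    \<open>a\<close> does not, so \<open>a\<close> can be deleted; this deletion makes the count
    strict.\<close>
  have "S \<subseteq> head G ` (?A - {a})"
  proof
    fix y assume y: "y \<in> S"
    with S obtain e where "e \<in> arcs G" "tail G e \<in> verts G - S" "head G e = y"
      by (rule visibility_set_last_arc)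
    with y a show "y \<in> head G ` (?A - {a})"
      by (intro image_eqI[of _ _ e]) auto
  qed
  then have "card S \<le> card (?A - {a})"
    using fin by (metis card_image_le card_mono finite_Diff finite_imageI le_trans)
  also have "\<dots> < card ?A"
    using fin \<open>a \<in> ?A\<close> by (rule card_Diff1_less)
  also have "\<dots> \<le> (\<Sum>t\<in>verts G - S. out_degree G t)"
    unfolding out_degree_def by (rule card_UN_le) simp
  also have "\<dots> \<le> card (verts G - S) * max_degree G"
    using out_degree_le_max_degree sum_bounded_above[of "verts G - S" "out_degree G" "max_degree G"]
    by simp
  finally show ?thesis .
qed

theorem vv_le:
  assumes "arcs G \<noteq> {}" "\<nexists>u. universal_vertex G u"
  shows "int (vv G) \<le>
    \<lfloor>(real (card (verts G)) * real (max_degree G) - 1) / (real (max_degree G) + 1)\<rfloor>"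
proof -
  have "verts G \<noteq> {}"
    using assms(1) tail_in_verts by blast
  then obtain x S where S: "x \<in> verts G" "visibility_set G x S" "vv G = card S"
    by (rule vv_attained)
  then have sub: "S \<subseteq> verts G"
    by (auto simp: visibility_set_def)
  have "card S < card (verts G - S) * max_degree G"
    using card_visibility_set_less assms S by blast
  moreover have "card (verts G) = card (verts G - S) + card S"
    using sub by (metis card_Diff_subset card_mono finite_subset finite_verts le_add_diff_inverse2)
  \<comment> \<open>With s = |S|, the strict inequality s < (n - s) \<Delta> between naturals
    becomes s (\<Delta> + 1) + 1 \<le> n \<Delta>; the 1 gained is the -1 in the numerator of the
    bound.\<close>
  ultimately have "card S * (max_degree G + 1) + 1 \<le> card (verts G) * max_degree G"
    by (simp add: algebra_simps)
  then have "real (card S * (max_degree G + 1) + 1) \<le> real (card (verts G) * max_degree G)"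
    by (rule of_nat_mono)
  then show ?thesis
    by (simp add: S(3) le_floor_iff pos_le_divide_eq algebra_simps)
qed

end

section \<open>Sharpness for complete multipartite graphs with parts of size 2\<close>

lemma pair_graph_complete_multipartite: "pair_graph (complete_multipartite k m)"
proof
  have "finite (({..<k} \<times> {..<m}) \<times> ({..<k} \<times> {..<m}))"
    by simp
  then show "finite (parcs (complete_multipartite k m))"
    by (rule finite_subset[rotated]) (auto simp: complete_multipartite_def)
qed (auto simp: complete_multipartite_def symmetric_def sym_def)

lemma out_degree_complete_multipartite:
  assumes "v \<in> pverts (complete_multipartite k m)"
  shows "out_degree (with_proj (complete_multipartite k m)) v = (k - 1) * m"
proof -
  have "out_arcs (with_proj (complete_multipartite k m)) v = Pair v ` (({..<k} - {fst v}) \<times> {..<m})"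
    using assms by (auto simp: complete_multipartite_def out_arcs_def)
  moreover have "card (Pair v ` (({..<k} - {fst v}) \<times> {..<m})) = card (({..<k} - {fst v}) \<times> {..<m})"
    by (intro card_image inj_onI) auto
  ultimately show ?thesis
    using assms by (auto simp: out_degree_def complete_multipartite_def card_cartesian_product)
qed

lemma max_degree_complete_multipartite:
  assumes "0 < k" "0 < m"
  shows "max_degree (with_proj (complete_multipartite k m)) = (k - 1) * m"
proof -
  \<comment> \<open>A vertex is needed for the set of degrees to be a singleton rather than
    empty.\<close>
  have "(0, 0) \<in> pverts (complete_multipartite k m)"
    using assms by (simp add: complete_multipartite_def)
  then have "out_degree (with_proj (complete_multipartite k m)) ` pverts (complete_multipartite k m)
      = {(k - 1) * m}"
    using out_degree_complete_multipartite by (auto intro!: image_eqI[of _ _ "(0, 0)"])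
  then show ?thesis
    by (simp add: max_degree_def)
qed

lemma no_universal_vertex_complete_multipartite:
  assumes "2 \<le> m"
  shows "\<not> universal_vertex (with_proj (complete_multipartite k m)) u"
proof
  assume u: "universal_vertex (with_proj (complete_multipartite k m)) u"
  \<comment> \<open>Another vertex of the part of \<open>u\<close>, which exists because parts have
    at least two elements.\<close>
  let ?v = "(fst u, if snd u = 0 then 1 else 0)"
  have "?v \<in> pverts (complete_multipartite k m) - {u}"
    using u assms by (cases u) (auto simp: universal_vertex_def complete_multipartite_def)
  with u have "(u, ?v) \<in> parcs (complete_multipartite k m)"
    by (auto simp: universal_vertex_def)
  then show False
    by (simp add: complete_multipartite_def)
qed

lemma vv_complete_multipartite_ge:
  assumes "0 < k" "0 < m"
  shows "(k - 1) * m \<le> vv (with_proj (complete_multipartite k m))"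
proof -
  interpret pair_graph "complete_multipartite k m"
    by (rule pair_graph_complete_multipartite)
  have "visibility_set (with_proj (complete_multipartite k m)) (0, 0) ({1..<k} \<times> {..<m})"
    using assms by (intro visibility_set_neighbours) (auto simp: complete_multipartite_def)
  then have "card ({1..<k} \<times> {..<m}) \<le> vv (with_proj (complete_multipartite k m))"
    using assms by (intro card_visibility_set_le_vv) (auto simp: complete_multipartite_def)
  then show ?thesis
    by (simp add: card_cartesian_product)
qed

text \<open>Here \<Delta> = 2(k - 1) and n = \<Delta> + 2, so the quotient is \<Delta> + 1 -
  2/(\<Delta> + 1), which lies in [\<Delta>, \<Delta> + 1) as \<Delta> \<ge> 1.\<close>

lemma cocktail_party_bound_eq:
  assumes "2 \<le> k"
  shows "\<lfloor>(real (card (verts (cocktail_party k))) * real (max_degree (cocktail_party k)) - 1)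
      / (real (max_degree (cocktail_party k)) + 1)\<rfloor> = int ((k - 1) * 2)"
proof -
  have "card (verts (cocktail_party k)) = k * 2"
    by (simp add: complete_multipartite_def card_cartesian_product)
  \<comment> \<open>Writing \<open>k\<close> as \<open>j + 2\<close> removes the truncated
    subtraction \<open>k - 1\<close>.\<close>
  moreover obtain j where "k = j + 2"
    using assms by (metis add.commute le_Suc_ex)
  ultimately show ?thesis
    by (intro floor_unique) (simp_all add: max_degree_complete_multipartite field_simps)
qed

theorem theorem3p4:
  shows "(\<forall>G :: ('a, 'b) pre_digraph.
            graph G \<longrightarrow> arcs G \<noteq> {} \<longrightarrow> (\<nexists>u. universal_vertex G u) \<longrightarrow>
            int (vv G) \<le> \<lfloor>(real (card (verts G)) * real (max_degree G) - 1)
                            / (real (max_degree G) + 1)\<rfloor>) \<and>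
         (\<forall>k \<ge> 2.
            graph (cocktail_party k) \<and> arcs (cocktail_party k) \<noteq> {} \<and>
            (\<nexists>u. universal_vertex (cocktail_party k) u) \<and>
            int (vv (cocktail_party k)) =
              \<lfloor>(real (card (verts (cocktail_party k))) * real (max_degree (cocktail_party k)) - 1)
                / (real (max_degree (cocktail_party k)) + 1)\<rfloor>)"
proof (intro conjI allI impI)
  fix G :: "('a, 'b) pre_digraph"
  assume "graph G" and *: "arcs G \<noteq> {}" "\<nexists>u. universal_vertex G u"
  then interpret graph G
    by simp
  show "int (vv G) \<le> \<lfloor>(real (card (verts G)) * real (max_degree G) - 1)
      / (real (max_degree G) + 1)\<rfloor>"
    using * by (rule vv_le)
next
  fix k :: nat
  assume k: "2 \<le> k"
  interpret C: pair_graph "complete_multipartite k 2"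
    by (rule pair_graph_complete_multipartite)
  show "graph (cocktail_party k)"
    by (rule C.pair_graphD_graph)
  have "((0, 0), (1, 0)) \<in> arcs (cocktail_party k)"
    using k by (simp add: complete_multipartite_def)
  then show arcs: "arcs (cocktail_party k) \<noteq> {}"
    by blast
  show nu: "\<nexists>u. universal_vertex (cocktail_party k) u"
    by (simp add: no_universal_vertex_complete_multipartite)
  have "int (vv (cocktail_party k)) \<le>
      \<lfloor>(real (card (verts (cocktail_party k))) * real (max_degree (cocktail_party k)) - 1)
        / (real (max_degree (cocktail_party k)) + 1)\<rfloor>"
    by (rule fin_digraph.vv_le[OF C.fin_digraph arcs nu])
  moreover have "(k - 1) * 2 \<le> vv (cocktail_party k)"
    using k by (intro vv_complete_multipartite_ge) auto
  ultimately show "int (vv (cocktail_party k)) =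
      \<lfloor>(real (card (verts (cocktail_party k))) * real (max_degree (cocktail_party k)) - 1)
        / (real (max_degree (cocktail_party k)) + 1)\<rfloor>"
    unfolding cocktail_party_bound_eq[OF k] by linarith
qed

end
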